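(* Let $N \ge 1$ be an integer, let $d_1 < d_2 < \ldots < d_N$ be real numbers, let $w_1, \ldots, w_N > 0$ be real weights, let $\gamma > 0$ and let $x \in \mathbb{R}$. Set $d_0 := -\infty$, $d_{N+1} := +\infty$ and let $\mu_i$ ($0 \le i \le N+1$) and $\nu_i$ ($1 \le i \le N+2$) be the forward and reverse cumulative weights defined in the context. Let $k$ be the smallest index in $\{1, \ldots, N+1\}$ satisfying $$\gamma\,(\mu_k - \nu_{k+1}) + d_k - x \ge 0,$$ and set $$y^* := \min\{\, d_k,\; x - \gamma\,(\mu_{k-1} - \nu_k)\,\}.$$ Then $y^* = \operatorname{prox}_{\gamma f}(x)$, i.e., $y^*$ is the unique solution of the problem $$\text{minimize} \quad \gamma \sum_{i=1}^N w_i\,|y - d_i| + \frac{1}{2}(y - x)^2 \quad \text{over } y \in \mathbb{R}.$$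
   Context: The weighted mean absolute error is the function $f\colon \mathbb{R} \to \mathbb{R}$, $f(y) := \sum_{i=1}^N w_i\,|y - d_i|$. For $\gamma > 0$, its proximal map is $\operatorname{prox}_{\gamma f}(x) := \operatorname{argmin}_{y \in \mathbb{R}} \left( \gamma f(y) + \tfrac{1}{2}(y-x)^2 \right)$. The forward and reverse cumulative weights are $\mu_i := \sum_{j=1}^i w_j$ and $\nu_i := \sum_{j=i}^N w_j$ for $i = 1, \ldots, N$, extended by $\mu_0 := 0$, $\mu_{N+1} := \mu_N$ and $\nu_{N+1} := \nu_{N+2} := 0$. Expressions involving $d_{N+1} = +\infty$ use the usual extended-real conventions: for $k = N+1$, the inequality $\gamma(\mu_k - \nu_{k+1}) + d_k - x \ge 0$ holds automatically, and $\min\{d_{N+1}, a\} = a$ for every real $a$. The procedure "find the smallest such index $k$, then return $y^*$" is the algorithm whose correctness is asserted. *)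

theory Defs
  imports Complex_Main "HOL-Library.Extended_Real"
begin

text \<open>Data points \<open>d\<close> and weights \<open>w\<close> are functions on \<open>nat\<close> of which only the values at the
  indices \<open>1, \<dots>, N\<close> are used.\<close>

definition wmae :: "nat \<Rightarrow> (nat \<Rightarrow> real) \<Rightarrow> (nat \<Rightarrow> real) \<Rightarrow> real \<Rightarrow> real" where
  "wmae N w d y = (\<Sum>i=1..N. w i * \<bar>y - d i\<bar>)"

text \<open>\<^const>\<open>arg_min\<close> returns some minimizer; uniqueness is not built into this definition.\<close>

definition prox :: "real \<Rightarrow> (real \<Rightarrow> real) \<Rightarrow> real \<Rightarrow> real" where
  "prox \<gamma> f x = (ARG_MIN (\<lambda>y. \<gamma> * f y + 1/2 * (y - x)^2) y. True)"

text \<open>The truncation \<open>min i N\<close> accounts for the convention \<open>\<mu>\<^sub>N\<^sub>+\<^sub>1 = \<mu>\<^sub>N\<close>.\<close>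

definition fwd_weight :: "nat \<Rightarrow> (nat \<Rightarrow> real) \<Rightarrow> nat \<Rightarrow> real" where
  "fwd_weight N w i = (\<Sum>j=1..min i N. w j)"

text \<open>For \<open>i > N\<close> the sum is empty, which gives \<open>\<nu>\<^sub>N\<^sub>+\<^sub>1 = \<nu>\<^sub>N\<^sub>+\<^sub>2 = 0\<close>.\<close>

definition rev_weight :: "nat \<Rightarrow> (nat \<Rightarrow> real) \<Rightarrow> nat \<Rightarrow> real" where
  "rev_weight N w i = (\<Sum>j=i..N. w j)"

definition ext_points :: "nat \<Rightarrow> (nat \<Rightarrow> real) \<Rightarrow> nat \<Rightarrow> ereal" where
  "ext_points N d i = (if i = 0 then -\<infinity> else if i \<le> N then ereal (d i) else \<infinity>)"

definition stop_cond ::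
    "nat \<Rightarrow> (nat \<Rightarrow> real) \<Rightarrow> (nat \<Rightarrow> real) \<Rightarrow> real \<Rightarrow> real \<Rightarrow> nat \<Rightarrow> bool" where
  "stop_cond N w d \<gamma> x k \<longleftrightarrow>
     ereal (\<gamma> * (fwd_weight N w k - rev_weight N w (k + 1))) + ext_points N d k - ereal x \<ge> 0"

definition stop_index ::
    "nat \<Rightarrow> (nat \<Rightarrow> real) \<Rightarrow> (nat \<Rightarrow> real) \<Rightarrow> real \<Rightarrow> real \<Rightarrow> nat" where
  "stop_index N w d \<gamma> x = (LEAST k. k \<in> {1..N + 1} \<and> stop_cond N w d \<gamma> x k)"

text \<open>The set over which \<^const>\<open>stop_index\<close> takes the least element is never empty.\<close>

lemma stop_index:
  "stop_index N w d \<gamma> x \<in> {1..N + 1} \<and> stop_cond N w d \<gamma> x (stop_index N w d \<gamma> x)"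
  unfolding stop_index_def
  by (rule LeastI[where k = "N + 1"]) (simp add: stop_cond_def ext_points_def)

definition prox_alg ::
    "nat \<Rightarrow> (nat \<Rightarrow> real) \<Rightarrow> (nat \<Rightarrow> real) \<Rightarrow> real \<Rightarrow> real \<Rightarrow> ereal" where
  "prox_alg N w d \<gamma> x =
     (let k = stop_index N w d \<gamma> x
      in min (ext_points N d k)
             (ereal (x - \<gamma> * (fwd_weight N w (k - 1) - rev_weight N w k))))"

end

theory Submission imports Defs begin

text \<open>If \<open>s\<^sub>i\<close> is a subgradient of \<open>\<bar>\<cdot>\<bar>\<close> at \<open>p - d\<^sub>i\<close> and
  \<open>\<gamma> (\<Sum>i. w\<^sub>i s\<^sub>i) + p - x = 0\<close>, then by strong convexity the objective at \<open>y\<close> exceeds its value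
  at \<open>p\<close> by at least \<open>(y - p)\<^sup>2 / 2\<close>, so \<open>p\<close> is the unique minimizer. The stopping index \<open>k\<close>
  satisfies \<open>d\<^sub>k\<^sub>-\<^sub>1 < y\<^sup>* \<le> d\<^sub>k\<close>, where the strict inequality holds because the stopping test fails at
  \<open>k - 1\<close>. Hence \<open>s\<^sub>i = 1\<close> for \<open>i < k\<close> and \<open>s\<^sub>i = -1\<close> for \<open>i > k\<close> are subgradients at
  \<open>p = y\<^sup>*\<close>. If \<open>y\<^sup>* < d\<^sub>k\<close>, then \<open>s\<^sub>k = -1\<close> solves the equation; if \<open>y\<^sup>* = d\<^sub>k\<close>, its left-hand side
  is nonpositive for \<open>s\<^sub>k = -1\<close> and, by the stopping test, nonnegative for \<open>s\<^sub>k = 1\<close>, so some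
  \<open>s\<^sub>k\<close> in between solves it.\<close>

lemma weighted_abs_prox_growth:
  fixes w d s :: "'a \<Rightarrow> real" and \<gamma> x p y :: real
  assumes "\<gamma> \<ge> 0" and w: "\<And>i. i \<in> A \<Longrightarrow> w i \<ge> 0"
    and s: "\<And>i. i \<in> A \<Longrightarrow> \<bar>s i\<bar> \<le> 1" "\<And>i. i \<in> A \<Longrightarrow> s i * (p - d i) = \<bar>p - d i\<bar>"
    and stationary: "\<gamma> * (\<Sum>i\<in>A. w i * s i) + p - x = 0"
  shows "\<gamma> * (\<Sum>i\<in>A. w i * \<bar>p - d i\<bar>) + 1/2 * (p - x)^2 + 1/2 * (y - p)^2
    \<le> \<gamma> * (\<Sum>i\<in>A. w i * \<bar>y - d i\<bar>) + 1/2 * (y - x)^2"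
proof -
  have "(\<Sum>i\<in>A. w i * \<bar>p - d i\<bar>) + (\<Sum>i\<in>A. w i * s i) * (y - p)
      = (\<Sum>i\<in>A. w i * (s i * (y - d i)))"
    unfolding sum_distrib_right sum.distrib[symmetric]
    by (intro sum.cong refl) (simp add: s(2)[symmetric] algebra_simps)
  also have "\<dots> \<le> (\<Sum>i\<in>A. w i * \<bar>y - d i\<bar>)"
  proof (intro sum_mono mult_left_mono w)
    fix i assume "i \<in> A"
    have "s i * (y - d i) \<le> \<bar>s i\<bar> * \<bar>y - d i\<bar>"
      by (metis abs_ge_self abs_mult)
    also have "\<dots> \<le> \<bar>y - d i\<bar>"
      using s(1)[OF \<open>i \<in> A\<close>] by (simp add: mult_left_le_one_le)
    finally show "s i * (y - d i) \<le> \<bar>y - d i\<bar>" .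
  qed
  finally have "\<gamma> * (\<Sum>i\<in>A. w i * \<bar>p - d i\<bar>) + \<gamma> * (\<Sum>i\<in>A. w i * s i) * (y - p)
      \<le> \<gamma> * (\<Sum>i\<in>A. w i * \<bar>y - d i\<bar>)"
    using mult_left_mono[OF _ \<open>\<gamma> \<ge> 0\<close>] by (metis distrib_left mult.assoc)
  moreover have "\<gamma> * (\<Sum>i\<in>A. w i * s i) = x - p"
    using stationary by simp
  \<comment> \<open>The cross term \<open>(x - p) * (y - p)\<close> is exactly the linear term of
    the summed subgradient inequality.\<close>
  moreover have "1/2 * (p - x)^2 + 1/2 * (y - p)^2 = 1/2 * (y - x)^2 + (x - p) * (y - p)"
    by (simp add: power2_eq_square field_simps)
  ultimately show ?thesis
    by simp
qed

text \<open>For \<open>t = -1\<close> and \<open>t = 1\<close> the right-hand side becomes the two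
  weight differences of the algorithm: the one in the second argument of the minimum and the one in
  the stopping test.\<close>

lemma sum_threshold_signs:
  assumes "1 \<le> k" "k \<le> N"
  shows "(\<Sum>i=1..N. w i * (if i < k then 1 else if i = k then t else - 1))
    = fwd_weight N w (k - 1) + t * w k - rev_weight N w (k + 1)"
proof -
  let ?f = "\<lambda>i. w i * (if i < k then 1 else if i = k then t else - 1)"
  have "{1..N} = {1..k - 1} \<union> ({k} \<union> {k + 1..N})"
    using assms by auto
  moreover have "sum ?f ({1..k - 1} \<union> ({k} \<union> {k + 1..N}))
      = sum ?f {1..k - 1} + sum ?f ({k} \<union> {k + 1..N})"
    using assms by (intro sum.union_disjoint) auto
  moreover have "sum ?f ({k} \<union> {k + 1..N}) = sum ?f {k} + sum ?f {k + 1..N}"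
    by (intro sum.union_disjoint) auto
  ultimately have "sum ?f {1..N} = sum ?f {1..k - 1} + (t * w k + sum ?f {k + 1..N})"
    by simp
  also have "sum ?f {1..k - 1} = (\<Sum>i=1..k - 1. w i)"
    using assms by (intro sum.cong) auto
  also have "sum ?f {k + 1..N} = (\<Sum>i=k + 1..N. - w i)"
    by (intro sum.cong) auto
  finally show ?thesis
    using assms by (simp add: fwd_weight_def rev_weight_def sum_negf)
qed

lemma fwd_weight_step:
  assumes "1 \<le> k" "k \<le> N"
  shows "fwd_weight N w k = fwd_weight N w (k - 1) + w k"
  using assms by (cases k) (auto simp: fwd_weight_def)

lemma rev_weight_step:
  assumes "k \<le> N"
  shows "rev_weight N w k = w k + rev_weight N w (k + 1)"
  using assms by (simp add: rev_weight_def sum.atLeast_Suc_atMost)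

lemma stop_cond_iff:
  assumes "1 \<le> k" "k \<le> N"
  shows "stop_cond N w d \<gamma> x k
    \<longleftrightarrow> x \<le> \<gamma> * (fwd_weight N w k - rev_weight N w (k + 1)) + d k"
  using assms by (auto simp: stop_cond_def ext_points_def zero_ereal_def)

lemma not_stop_cond_before:
  assumes "k \<in> {1..N + 1}" "k < stop_index N w d \<gamma> x"
  shows "\<not> stop_cond N w d \<gamma> x k"
  using not_less_Least[OF assms(2)[unfolded stop_index_def]] assms(1) by simp

lemma prox_alg_stationary:
  assumes d: "strict_mono_on {1..N} d" and w: "\<forall>i\<in>{1..N}. w i > 0" and "\<gamma> > 0"
  obtains p s where "prox_alg N w d \<gamma> x = ereal p"
    and "\<forall>i\<in>{1..N}. \<bar>s i\<bar> \<le> 1"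
    and "\<forall>i\<in>{1..N}. s i * (p - d i) = \<bar>p - d i\<bar>"
    and "\<gamma> * (\<Sum>i=1..N. w i * s i) + p - x = 0"
proof -
  define k where "k = stop_index N w d \<gamma> x"
  define a where "a = x - \<gamma> * (fwd_weight N w (k - 1) - rev_weight N w k)"
  \<comment> \<open>The value \<open>d (N + 1)\<close> is arbitrary, so the convention for an
    infinite last point needs the case split.\<close>
  define p where "p = (if k \<le> N then min (d k) a else a)"
  have k: "1 \<le> k" "k \<le> N + 1" and stop: "stop_cond N w d \<gamma> x k"
    using stop_index[of N w d \<gamma> x] by (auto simp: k_def)
  have alg: "prox_alg N w d \<gamma> x = ereal p"
    using k by (auto simp: prox_alg_def Let_def k_def[symmetric] ext_points_def p_def a_def min_def)
  have left: "d i < p" if "1 \<le> i" "i < k" for i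
  proof -
    have "\<not> stop_cond N w d \<gamma> x (k - 1)"
      using that k by (intro not_stop_cond_before) (auto simp: k_def)
    \<comment> \<open>The test at \<open>k - 1\<close> involves the same weight difference as
      \<open>a\<close>, so its failure is this very inequality.\<close>
    then have "d (k - 1) < a"
      using that k by (auto simp: stop_cond_iff a_def)
    moreover have "d i \<le> d (k - 1)"
      using that k by (intro mono_onD[OF strict_mono_on_imp_mono_on[OF d]]) auto
    moreover have "d i < d k" if "k \<le> N"
      using \<open>1 \<le> i\<close> \<open>i < k\<close> that by (intro strict_mono_onD[OF d]) auto
    ultimately show ?thesis
      by (auto simp: p_def)
  qed
  have right: "p < d i" if "k < i" "i \<le> N" for i
  proof -
    have "d k < d i"
      using that k by (intro strict_mono_onD[OF d]) auto
    then show ?thesis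
      using that by (auto simp: p_def)
  qed
  have "\<exists>t. \<bar>t\<bar> \<le> 1 \<and> (k \<le> N \<longrightarrow> t * (p - d k) = \<bar>p - d k\<bar>) \<and>
      \<gamma> * (\<Sum>i=1..N. w i * (if i < k then 1 else if i = k then t else - 1)) + p - x = 0"
  proof (cases "k \<le> N")
    case False
    then have "k = N + 1"
      using k by simp
    then have "(\<Sum>i=1..N. w i * (if i < k then 1 else if i = k then 1 else - 1))
        = fwd_weight N w (k - 1) - rev_weight N w k"
      by (auto simp: fwd_weight_def rev_weight_def intro!: sum.cong)
    then show ?thesis
      \<comment> \<open>The witness 1 is arbitrary: index \<open>k\<close> lies outside the
        sum.\<close>
      using False by (intro exI[of _ 1]) (simp add: p_def a_def)
  next
    case True
    note sum = sum_threshold_signs[OF k(1) True, of w]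
    show ?thesis
    proof (cases "a \<le> d k")
      case True
      then have "p = a"
        by (simp add: p_def)
      \<comment> \<open>With \<open>t = -1\<close> the stationarity equation is the definition of
        \<open>a\<close>; this also covers the tie \<open>a = d k\<close>.\<close>
      with True show ?thesis
        using rev_weight_step[OF \<open>k \<le> N\<close>, of w]
        by (intro exI[of _ "- 1"]) (simp only: sum, simp add: a_def)
    next
      case False
      \<comment> \<open>This is the stationarity equation at \<open>p = d k\<close> solved for
        \<open>t\<close>. The stopping test will give \<open>t \<le> 1\<close>, and
        \<open>d k < a\<close> will give \<open>-1 \<le> t\<close>.\<close>
      define t where
        "t = ((x - d k) / \<gamma> - (fwd_weight N w (k - 1) - rev_weight N w (k + 1))) / w k"
      have "w k > 0"
        using w k True by auto
      have p: "p = d k"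
        using False True by (simp add: p_def)
      have "x - d k \<le> \<gamma> * (fwd_weight N w k - rev_weight N w (k + 1))"
        using stop True k by (simp add: stop_cond_iff)
      moreover have "\<gamma> * (fwd_weight N w (k - 1) - rev_weight N w k) \<le> x - d k"
        using False by (simp add: a_def)
      ultimately have "(x - d k) / \<gamma> \<le> fwd_weight N w k - rev_weight N w (k + 1)"
        and "fwd_weight N w (k - 1) - rev_weight N w k \<le> (x - d k) / \<gamma>"
        using \<open>\<gamma> > 0\<close> by (simp_all only: pos_divide_le_eq pos_le_divide_eq mult.commute)
      then have "\<bar>t\<bar> \<le> 1"
        using \<open>w k > 0\<close>
        unfolding t_def fwd_weight_step[OF k(1) True] rev_weight_step[OF True] abs_le_iff
        by (simp add: pos_divide_le_eq pos_le_divide_eq minus_divide_left)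
      moreover have "\<gamma> * (fwd_weight N w (k - 1) + t * w k - rev_weight N w (k + 1)) + p - x = 0"
        using \<open>\<gamma> > 0\<close> \<open>w k > 0\<close> by (simp add: t_def p)
      ultimately show ?thesis
        by (intro exI[of _ t]) (simp only: sum p, simp)
    qed
  qed
  then obtain t where t: "\<bar>t\<bar> \<le> 1" "k \<le> N \<Longrightarrow> t * (p - d k) = \<bar>p - d k\<bar>"
    and eq: "\<gamma> * (\<Sum>i=1..N. w i * (if i < k then 1 else if i = k then t else - 1)) + p - x = 0"
    by blast
  show thesis
  proof (rule that[OF alg _ _ eq]; intro ballI)
    fix i assume i: "i \<in> {1..N}"
    show "\<bar>if i < k then 1 else if i = k then t else - 1\<bar> \<le> 1"
      using t(1) by auto
    show "(if i < k then 1 else if i = k then t else - 1) * (p - d i) = \<bar>p - d i\<bar>"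
      using i t(2) left[of i] right[of i] by (cases i k rule: linorder_cases) auto
  qed
qed

theorem theorem2p1:
  fixes N :: nat and d w :: "nat \<Rightarrow> real" and \<gamma> x :: real
  assumes "N \<ge> 1"
    and "strict_mono_on {1..N} d"
    and "\<forall>i\<in>{1..N}. w i > 0"
    and "\<gamma> > 0"
  shows "prox_alg N w d \<gamma> x = ereal (prox \<gamma> (wmae N w d) x) \<and>
      (\<forall>y. is_arg_min (\<lambda>y. \<gamma> * (\<Sum>i=1..N. w i * \<bar>y - d i\<bar>) + 1/2 * (y - x)^2) (\<lambda>_. True) y
           \<longleftrightarrow> ereal y = prox_alg N w d \<gamma> x)"
proof -
  define F where "F = (\<lambda>y. \<gamma> * (\<Sum>i=1..N. w i * \<bar>y - d i\<bar>) + 1/2 * (y - x)^2)"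
  obtain p s where alg: "prox_alg N w d \<gamma> x = ereal p"
    and s: "\<forall>i\<in>{1..N}. \<bar>s i\<bar> \<le> 1"
      "\<forall>i\<in>{1..N}. s i * (p - d i) = \<bar>p - d i\<bar>"
      "\<gamma> * (\<Sum>i=1..N. w i * s i) + p - x = 0"
    by (rule prox_alg_stationary[OF assms(2-4), of x])
  have growth: "F p + 1/2 * (y - p)^2 \<le> F y" for y
    unfolding F_def
  proof (rule weighted_abs_prox_growth[OF _ _ _ _ s(3)])
    show "0 \<le> w i" if "i \<in> {1..N}" for i
      using assms(3) that by (blast intro: less_imp_le)
  qed (use less_imp_le[OF \<open>\<gamma> > 0\<close>] s in blast)+
  have less: "F p < F y" if "y \<noteq> p" for y
  proof -
    have "1/2 * (y - p)^2 > 0"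
      using that by simp
    with growth[of y] show ?thesis
      by linarith
  qed
  have min: "is_arg_min F (\<lambda>_. True) y \<longleftrightarrow> y = p" for y
    using less less_asym unfolding is_arg_min_def by blast
  \<comment> \<open>Since \<open>p\<close> is the only minimizer, the choice made by
    \<open>arg_min\<close> is forced.\<close>
  have "prox \<gamma> (wmae N w d) x = p"
    unfolding prox_def wmae_def F_def[symmetric] arg_min_def min by simp
  then show ?thesis
    unfolding F_def[symmetric] min alg by simp
qed

end
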